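(* Let $A$ be an LR-type fuzzy number whose shape functions $L$ and $R$ are injective, and let $B$ be a fuzzy number that is completely correlated to $A$ (that is, $A$ and $B$ are completely correlated). Then $B$ is also an LR-type fuzzy number.
   Context: A fuzzy subset $A$ of a topological space $U$ (here $U=\mathbb{R}$ or $\mathbb{R}^2$) is given by its membership function $\varphi_A : U \to [0,1]$; one also writes $A(u)$ for $\varphi_A(u)$. For $\alpha \in (0,1]$ its $\alpha$-level is $[A]^{\alpha} = \{u \in U : \varphi_A(u) \ge \alpha\}$, and $[A]^0 = \overline{\{u \in U : \varphi_A(u) > 0\}}$ is the closure of the support. A fuzzy number is a fuzzy subset $A$ of $\mathbb{R}$ such that, for every $\alpha \in [0,1]$, $[A]^{\alpha}$ is a non-empty bounded closed interval of $\mathbb{R}$. A fuzzy number $A$ is of LR-type if there exist real numbers $q_- \le q_+$, $a, b > 0$, and non-increasing continuous functions $L, R : [0,1] \to [0,1]$ (the shape functions) with $L(0)=R(0)=1$ and $L(1)=R(1)=0$, such that $A(u) = L\left(\frac{q_- - u}{a}\right)$ for $u \in [q_- - a, q_-]$, $A(u) = 1$ for $u \in [q_-, q_+]$, $A(u) = R\left(\frac{u - q_+}{b}\right)$ for $u \in [q_+, q_+ + b]$, and $A(u) = 0$ otherwise. The shape functions are part of the existential data, so two LR-type fuzzy numbers need not share the same $L$ and $R$. A fuzzy subset $C$ of $\mathbb{R}^2$ is a joint possibility distribution of fuzzy numbers $A$ and $B$ if $\max_{y \in \mathbb{R}} \varphi_C(x,y) = \varphi_A(x)$ for all $x \in \mathbb{R}$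 and $\max_{x \in \mathbb{R}} \varphi_C(x,y) = \varphi_B(y)$ for all $y \in \mathbb{R}$. Two fuzzy numbers $A$ and $B$ are completely correlated if there exist $q, r \in \mathbb{R}$ with $q \neq 0$ such that they have a joint possibility distribution $C$ given by $\varphi_C(x,y) = \varphi_A(x)\, \chi_{qx+r=y}(x,y) = \varphi_B(y)\, \chi_{qx+r=y}(x,y)$ for all $(x,y) \in \mathbb{R}^2$, where $\chi_{qx+r=y}$ is the characteristic function of the line $\{(x,y) \in \mathbb{R}^2 : qx + r = y\}$. *)

theory Defs
  imports "HOL-Analysis.Analysis"
begin

text \<open>Fuzzy subsets are represented by their membership functions.\<close>

definition fuzzy_subset :: "('a \<Rightarrow> real) \<Rightarrow> bool" where
  "fuzzy_subset A \<longleftrightarrow> (\<forall>u. A u \<in> {0..1})"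

text \<open>The \<open>0\<close>-level is the closure of the support; only \<open>\<alpha> \<in> [0,1]\<close> is meaningful.\<close>

definition alpha_level :: "('a::topological_space \<Rightarrow> real) \<Rightarrow> real \<Rightarrow> 'a set" where
  "alpha_level A \<alpha> = (if \<alpha> = 0 then closure {u. A u > 0} else {u. A u \<ge> \<alpha>})"

definition fuzzy_number :: "(real \<Rightarrow> real) \<Rightarrow> bool" where
  "fuzzy_number A \<longleftrightarrow> fuzzy_subset A \<and>
     (\<forall>\<alpha>\<in>{0..1}. \<exists>c d. c \<le> d \<and> alpha_level A \<alpha> = {c..d})"

text \<open>Shape functions are total on \<open>real\<close>, but only their values on \<open>[0,1]\<close> matter.\<close>

definition shape_function :: "(real \<Rightarrow> real) \<Rightarrow> bool" where
  "shape_function S \<longleftrightarrow> S \<in> {0..1} \<rightarrow> {0..1} \<and> antimono_on {0..1} S \<and>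
     continuous_on {0..1} S \<and> S 0 = 1 \<and> S 1 = 0"

definition LR_representation ::
  "(real \<Rightarrow> real) \<Rightarrow> (real \<Rightarrow> real) \<Rightarrow> (real \<Rightarrow> real) \<Rightarrow> real \<Rightarrow> real \<Rightarrow> real \<Rightarrow> real \<Rightarrow> bool" where
  "LR_representation A L R qm qp a b \<longleftrightarrow>
     shape_function L \<and> shape_function R \<and> qm \<le> qp \<and> a > 0 \<and> b > 0 \<and>
     (\<forall>u\<in>{qm - a..qm}. A u = L ((qm - u) / a)) \<and>
     (\<forall>u\<in>{qm..qp}. A u = 1) \<and>
     (\<forall>u\<in>{qp..qp + b}. A u = R ((u - qp) / b)) \<and>
     (\<forall>u. u \<notin> {qm - a..qp + b} \<longrightarrow> A u = 0)"

definition LR_fuzzy_number :: "(real \<Rightarrow> real) \<Rightarrow> bool" where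
  "LR_fuzzy_number A \<longleftrightarrow>
     fuzzy_number A \<and> (\<exists>L R qm qp a b. LR_representation A L R qm qp a b)"

text \<open>\<open>is_maximum f m\<close> says that \<open>m\<close> is the attained maximum of \<open>f\<close> (the library's \<open>Max\<close> is
  restricted to finite sets, and a supremum need not be attained).\<close>

definition is_maximum :: "('a \<Rightarrow> real) \<Rightarrow> real \<Rightarrow> bool" where
  "is_maximum f m \<longleftrightarrow> (\<exists>z. f z = m) \<and> (\<forall>z. f z \<le> m)"

definition joint_possibility_distribution ::
  "(real \<times> real \<Rightarrow> real) \<Rightarrow> (real \<Rightarrow> real) \<Rightarrow> (real \<Rightarrow> real) \<Rightarrow> bool" where
  "joint_possibility_distribution C A B \<longleftrightarrow> fuzzy_subset C \<and>
     (\<forall>x. is_maximum (\<lambda>y. C (x, y)) (A x)) \<and>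
     (\<forall>y. is_maximum (\<lambda>x. C (x, y)) (B y))"

definition completely_correlated :: "(real \<Rightarrow> real) \<Rightarrow> (real \<Rightarrow> real) \<Rightarrow> bool" where
  "completely_correlated A B \<longleftrightarrow>
     (\<exists>q r C. q \<noteq> 0 \<and> joint_possibility_distribution C A B \<and>
       (\<forall>x y. C (x, y) = A x * indicator {(x, y). q * x + r = y} (x, y) \<and>
              C (x, y) = B y * indicator {(x, y). q * x + r = y} (x, y)))"

end

theory Submission
  imports Defs
begin

text \<open>
  Complete correlation says that the joint distribution lives on the line \<open>y = q * x + r\<close>, and on
  that line its two expressions must agree: \<open>A x = B (q * x + r)\<close>. As \<open>q \<noteq> 0\<close>, the membership
  function of \<open>B\<close> is therefore that of \<open>A\<close> precomposed with the affine map \<open>y \<mapsto> (y - r) / q\<close>.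
  The LR-type fuzzy numbers are stable under such changes of variable: an increasing one moves
  the core endpoints by the map and rescales the two spreads, with the same shape functions
  (\<open>LR_representation_affine\<close>), and the reflection \<open>u \<mapsto> - u\<close> exchanges the left and the right
  data (\<open>LR_representation_reflect\<close>). A negative \<open>q\<close> is a reflection followed by the increasing
  map with slope \<open>- q\<close>.
\<close>

lemma completely_correlated_imp_affine:
  assumes "completely_correlated A B"
  obtains q r where "q \<noteq> 0" "B = (\<lambda>y. A ((y - r) / q))"
proof -
  obtain q r C where q: "q \<noteq> 0"
    and C: "\<And>x y. C (x, y) = A x * indicator {(x, y). q * x + r = y} (x, y)"
           "\<And>x y. C (x, y) = B y * indicator {(x, y). q * x + r = y} (x, y)"
    using assms unfolding completely_correlated_def by blast
  have "B y = A ((y - r) / q)" for y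
    using C[of "(y - r) / q" y] q by simp
  with q that show thesis by blast
qed

lemma LR_representation_affine:
  assumes "LR_representation A L R qm qp a b" "q > 0"
  shows "LR_representation (\<lambda>y. A ((y - r) / q)) L R (q * qm + r) (q * qp + r) (q * a) (q * b)"
proof -
  have le_iff: "c \<le> (u - r) / q \<longleftrightarrow> q * c + r \<le> u" "(u - r) / q \<le> c \<longleftrightarrow> u \<le> q * c + r" for u c
    using assms(2) by (auto simp: field_simps)
  have mem_iff: "(u - r) / q \<in> {c..d} \<longleftrightarrow> u \<in> {q * c + r..q * d + r}" for u c d
    by (simp add: le_iff)
  have shape_args: "(q * qm + r - u) / (q * a) = (qm - (u - r) / q) / a"
    "(u - (q * qp + r)) / (q * b) = ((u - r) / q - qp) / b" for u
    using assms unfolding LR_representation_def by (auto simp: field_simps)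
  have ends: "q * qm + r - q * a = q * (qm - a) + r" "q * qp + r + q * b = q * (qp + b) + r"
    by (simp_all add: algebra_simps)
  show ?thesis
    using assms unfolding LR_representation_def shape_args ends Ball_def mem_iff[symmetric] by simp
qed

lemma LR_representation_reflect:
  assumes "LR_representation A L R qm qp a b"
  shows "LR_representation (\<lambda>u. A (- u)) R L (- qp) (- qm) b a"
proof -
  have mem_iff: "- u \<in> {c..d} \<longleftrightarrow> u \<in> {- d..- c}" for u c d :: real
    by auto
  have shape_args: "(- qp - u) / b = (- u - qp) / b" "(u - (- qm)) / a = (qm - (- u)) / a" for u
    by simp_all
  have ends: "- qp - b = - (qp + b)" "- qm + a = - (qm - a)"
    by simp_all
  show ?thesis
    using assms unfolding LR_representation_def shape_args ends Ball_def mem_iff[symmetric] by simp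
qed

theorem corollary1:
  fixes A B L R :: "real \<Rightarrow> real" and qm qp a b :: real
  assumes "fuzzy_number A"
    and "LR_representation A L R qm qp a b"
    and "inj_on L {0..1}" and "inj_on R {0..1}"
    and "fuzzy_number B"
    and "completely_correlated A B"
  shows "LR_fuzzy_number B"
proof -
  obtain q r where "q \<noteq> 0" and B: "B = (\<lambda>y. A ((y - r) / q))"
    using assms(6) by (rule completely_correlated_imp_affine)
  have "\<exists>L R qm qp a b. LR_representation B L R qm qp a b"
  proof (cases "q > 0")
    case True
    then show ?thesis
      using LR_representation_affine[OF assms(2)] unfolding B by blast
  next
    case False
    with \<open>q \<noteq> 0\<close> have "- q > 0"
      by simp
    moreover have "B = (\<lambda>y. A (- ((y - r) / (- q))))"
      unfolding B by simp
    ultimately show ?thesis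
      using LR_representation_affine[OF LR_representation_reflect[OF assms(2)]] by metis
  qed
  with assms(5) show ?thesis
    unfolding LR_fuzzy_number_def by blast
qed

end
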